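(* Let $\alpha$ be the slope of an exceptional bundle on $\mathbb{P}^2$. Then every term in the even-length continued fraction expansion of the fractional part of $\alpha$ is a one or a two. Furthermore, these terms form a palindrome.
   Context: We work over $\mathbb{C}$. The slope of a sheaf $E$ of positive rank on $\mathbb{P}^2$ is $\mu(E)=c_1(E)/\operatorname{rk}(E)$. An exceptional bundle on $\mathbb{P}^2$ is a stable vector bundle $E$ with $\operatorname{Ext}^1(E,E)=0$. Equivalently (Drezet, Le Potier), the set of slopes of exceptional bundles is the image of the map $\varepsilon:\mathbb{Z}[\tfrac12]\to\mathbb{Q}$ defined inductively by $\varepsilon(n)=n$ for $n\in\mathbb{Z}$ and $\varepsilon\left(\frac{2p+1}{2^q}\right)=\varepsilon\left(\frac{p}{2^{q-1}}\right).\varepsilon\left(\frac{p+1}{2^{q-1}}\right)$ for $q\ge1$, where $\alpha.\beta=\frac{\alpha+\beta}{2}+\frac{\Delta_\beta-\Delta_\alpha}{3+\alpha-\beta}$, $\Delta_\alpha=\frac12\left(1-\frac{1}{r_\alpha^2}\right)$, and $r_\alpha$ is the denominator of $\alpha$ in lowest terms. Every rational number $0\le a<1$ has a unique continued fraction expansion $a=[0;a_1,\ldots,a_k]=0+\cfrac{1}{a_1+\cfrac{1}{\ddots+\cfrac{1}{a_k}}}$ with the $a_i$ positive integers and $k$ even (with $k=0$ for $a=0$); this is the even-length continued fraction expansion, and its terms are $a_1,\dots,a_k$. The terms form a palindrome if $a_i=a_{k+1-i}$ for all $i$. *)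

theory Defs
  imports Complex_Main
begin

section \<open>Slopes of exceptional bundles on the projective plane\<close>

definition slope_rank :: "rat \<Rightarrow> rat" where
  "slope_rank \<alpha> = of_int (snd (quotient_of \<alpha>))"

definition slope_discriminant :: "rat \<Rightarrow> rat" where
  "slope_discriminant \<alpha> = 1 / 2 * (1 - 1 / (slope_rank \<alpha>)^2)"

definition slope_dot :: "rat \<Rightarrow> rat \<Rightarrow> rat" where
  "slope_dot \<alpha> \<beta> =
     (\<alpha> + \<beta>) / 2 + (slope_discriminant \<beta> - slope_discriminant \<alpha>) / (3 + \<alpha> - \<beta>)"

definition dyadics :: "rat set" where
  "dyadics = {of_int p / 2 ^ q | (p :: int) (q :: nat). True}"

text \<open>
  The recursion for \<open>\<epsilon>\<close> is carried out on pairs, \<open>epsilon_level q p\<close> being the value at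
  \<open>p / 2 ^ q\<close>, where \<open>p\<close> may be even. Lemma \<open>epsilon_dyadic\<close> shows independence of the
  representation, and \<open>epsilon_of_int\<close> and \<open>epsilon_odd\<close> are the usual defining equations.
\<close>

fun epsilon_level :: "nat \<Rightarrow> int \<Rightarrow> rat" where
  "epsilon_level 0 p = of_int p"
| "epsilon_level (Suc q) p =
     (if even p then epsilon_level q (p div 2)
      else slope_dot (epsilon_level q (p div 2)) (epsilon_level q (p div 2 + 1)))"

text \<open>Only the values of \<open>epsilon\<close> on \<open>dyadics\<close> are meaningful.\<close>

definition epsilon :: "rat \<Rightarrow> rat" where
  "epsilon x = (let q = (LEAST q. x * 2 ^ q \<in> \<int>) in epsilon_level q \<lfloor>x * 2 ^ q\<rfloor>)"

lemma epsilon_level_shift: "epsilon_level (k + q) (p * 2 ^ k) = epsilon_level q p"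
  by (induction k) (simp_all add: mult.left_commute)

lemma epsilon_dyadic: "epsilon (of_int p / 2 ^ q) = epsilon_level q p"
proof -
  let ?x = "of_int p / 2 ^ q :: rat"
  define m where "m = (LEAST m. ?x * 2 ^ m \<in> \<int>)"
  have q: "?x * 2 ^ q \<in> \<int>" by simp
  have m: "?x * 2 ^ m \<in> \<int>" unfolding m_def by (rule LeastI[of _ q]) (rule q)
  have "m \<le> q" unfolding m_def by (rule Least_le) (rule q)
  then obtain k where k: "q = k + m" by (metis le_add_diff_inverse2)
  obtain n where n: "?x * 2 ^ m = of_int n" using m by (auto elim: Ints_cases)
  then have "(of_int p :: rat) = of_int n * 2 ^ k"
    by (simp add: k power_add field_simps)
  then have p: "p = n * 2 ^ k"
    by (metis of_int_eq_iff of_int_mult of_int_numeral of_int_power)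
  have "epsilon ?x = epsilon_level m n"
    by (simp only: epsilon_def Let_def m_def[symmetric] n floor_of_int)
  then show ?thesis using epsilon_level_shift[of k m n] by (simp add: k p)
qed

lemma epsilon_of_int: "epsilon (of_int n) = of_int n"
  using epsilon_dyadic[of n 0] by simp

lemma epsilon_odd:
  assumes "q \<ge> 1"
  shows "epsilon (of_int (2 * p + 1) / 2 ^ q) =
    slope_dot (epsilon (of_int p / 2 ^ (q - 1))) (epsilon (of_int (p + 1) / 2 ^ (q - 1)))"
proof -
  obtain r where "q = Suc r" using assms by (cases q) auto
  then show ?thesis by (simp only: epsilon_dyadic) simp
qed

text \<open>
  The Drezet--Le Potier description of the slopes of exceptional bundles, that is, of stable
  bundles \<open>E\<close> on the complex projective plane with \<open>Ext\<^sup>1(E, E) = 0\<close>.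
\<close>

definition exceptional_slopes :: "rat set" where
  "exceptional_slopes = epsilon ` dyadics"


section \<open>Even-length continued fractions\<close>

text \<open>\<open>cfrac_value [a\<^sub>1, \<dots>, a\<^sub>k]\<close> is the value of \<open>[0; a\<^sub>1, \<dots>, a\<^sub>k]\<close>.\<close>

fun cfrac_value :: "nat list \<Rightarrow> rat" where
  "cfrac_value [] = 0"
| "cfrac_value (a # as) = 1 / (of_nat a + cfrac_value as)"

definition is_even_cfrac :: "rat \<Rightarrow> nat list \<Rightarrow> bool" where
  "is_even_cfrac x as \<longleftrightarrow> even (length as) \<and> (\<forall>a \<in> set as. a > 0) \<and> cfrac_value as = x"

text \<open>Well defined for \<open>0 \<le> x < 1\<close> by lemma \<open>ex1_even_cfrac\<close> below.\<close>

definition even_cfrac :: "rat \<Rightarrow> nat list" where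
  "even_cfrac x = (THE as. is_even_cfrac x as)"

definition palindrome :: "'a list \<Rightarrow> bool" where
  "palindrome as \<longleftrightarrow> (\<forall>i < length as. as ! i = as ! (length as - 1 - i))"

lemma cfrac_value_bounds:
  assumes "\<forall>a \<in> set as. a > 0"
  shows "if even (length as) then 0 \<le> cfrac_value as \<and> cfrac_value as < 1
         else 0 < cfrac_value as \<and> cfrac_value as \<le> 1"
  using assms
proof (induction as)
  case Nil
  then show ?case by simp
next
  case (Cons a as)
  have "(of_nat a :: rat) \<ge> 1" using Cons.prems by (simp add: Suc_leI)
  with Cons show ?case by (auto simp: field_simps split: if_splits)
qed

lemma cfrac_value_inject:
  assumes "\<forall>a \<in> set as. a > 0" "\<forall>b \<in> set bs. b > 0"
    and "even (length as) = even (length bs)" and "cfrac_value as = cfrac_value bs"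
  shows "as = bs"
  using assms
proof (induction as arbitrary: bs)
  case Nil
  show ?case
  proof (cases bs)
    case (Cons b bs')
    have "(of_nat b :: rat) \<ge> 1" using Nil.prems Cons by (simp add: Suc_leI)
    with Nil.prems Cons cfrac_value_bounds[of bs'] show ?thesis by (auto split: if_splits)
  qed simp
next
  case (Cons a as)
  have a: "(of_nat a :: rat) \<ge> 1" using Cons.prems by (simp add: Suc_leI)
  have A: "if even (length as) then 0 \<le> cfrac_value as \<and> cfrac_value as < 1
         else 0 < cfrac_value as \<and> cfrac_value as \<le> 1"
    using Cons.prems by (intro cfrac_value_bounds) auto
  show ?case
  proof (cases bs)
    case Nil
    with Cons.prems A a show ?thesis by (auto split: if_splits)
  next
    case bs: (Cons b bs')
    have b: "(of_nat b :: rat) \<ge> 1" using Cons.prems bs by (simp add: Suc_leI)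
    have B: "if even (length bs') then 0 \<le> cfrac_value bs' \<and> cfrac_value bs' < 1
         else 0 < cfrac_value bs' \<and> cfrac_value bs' \<le> 1"
      using Cons.prems bs by (intro cfrac_value_bounds) auto
    have par: "even (length as) = even (length bs')" using Cons.prems bs by auto
    have eq: "of_nat a + cfrac_value as = of_nat b + cfrac_value bs'"
      using Cons.prems(4) bs by simp
    have "\<bar>cfrac_value as - cfrac_value bs'\<bar> < 1" using A B par by (auto split: if_splits)
    then have "\<bar>(of_nat a :: rat) - of_nat b\<bar> < 1" using eq by linarith
    then have "\<bar>(of_int (int a - int b) :: rat)\<bar> < of_int 1" by simp
    then have ab: "a = b" by (simp only: of_int_abs[symmetric] of_int_less_iff)
    with eq have "cfrac_value as = cfrac_value bs'" by simp
    with Cons.IH[of bs'] Cons.prems bs par ab show ?thesis by simp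
  qed
qed

lemma ex_cfrac:
  assumes "0 < m" "m \<le> n"
  shows "\<exists>as. (even (length as) \<longleftrightarrow> e) \<and> (\<forall>a \<in> set as. a > 0) \<and>
           cfrac_value as = of_nat m / of_nat n \<or> (e \<and> m = n)"
  using assms
proof (induction m arbitrary: n e rule: less_induct)
  case (less m)
  define a r where "a = n div m" and "r = n mod m"
  have n: "n = a * m + r" by (simp add: a_def r_def)
  have apos: "a > 0" using less.prems by (simp add: a_def div_greater_zero_iff)
  have rm: "r < m" using less.prems by (simp add: r_def)
  show ?case
  proof (cases "r = 0")
    case True
    show ?thesis
    proof (cases e)
      case False
      have "cfrac_value [a] = of_nat m / of_nat n"
        using True n less.prems by (simp add: field_simps)
      then show ?thesis using False apos by (intro exI[of _ "[a]"]) simp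
    next
      case e: True
      show ?thesis
      proof (cases "a = 1")
        case True
        then show ?thesis using n e \<open>r = 0\<close> by simp
      next
        case False
        then obtain b where b: "a = Suc b" "b > 0" using apos by (cases a) auto
        have "cfrac_value [b, 1] = of_nat m / of_nat n"
          using True n b less.prems by (simp add: divide_simps) (simp add: add_nonneg_eq_0_iff algebra_simps)
        then show ?thesis using e b by (intro exI[of _ "[b, 1]"]) simp
      qed
    qed
  next
    case False
    then obtain as where as: "even (length as) \<longleftrightarrow> \<not> e" "\<forall>a \<in> set as. a > 0"
      "cfrac_value as = of_nat r / of_nat m"
      using less.IH[of r m "\<not> e"] rm by auto
    have "(of_nat n :: rat) = of_nat m * (of_nat a + cfrac_value as)"
      using n as less.prems by (simp add: field_simps)
    then have "cfrac_value (a # as) = of_nat m / of_nat n"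
      using less.prems by simp
    then show ?thesis using as apos by (intro exI[of _ "a # as"]) auto
  qed
qed

lemma ex1_even_cfrac:
  assumes "0 \<le> x" "x < 1"
  shows "\<exists>!as. is_even_cfrac x as"
proof (rule ex_ex1I)
  show "\<exists>as. is_even_cfrac x as"
  proof (cases "x = 0")
    case True
    then show ?thesis by (intro exI[of _ "[]"]) (simp add: is_even_cfrac_def)
  next
    case False
    obtain p q where pq: "quotient_of x = (p, q)" by force
    have x: "x = of_int p / of_int q" and q: "q > 0"
      using pq quotient_of_div quotient_of_denom_pos by blast+
    have p: "0 < p" "p < q" using assms False x q by (auto simp: field_simps zero_le_divide_iff)
    have "x = of_nat (nat p) / of_nat (nat q)" using x p by simp
    then show ?thesis using ex_cfrac[of "nat p" "nat q" True] p q
      by (auto simp: is_even_cfrac_def nat_le_eq_zle)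
  qed
next
  show "as = bs" if "is_even_cfrac x as" "is_even_cfrac x bs" for as bs
    using that cfrac_value_inject by (auto simp: is_even_cfrac_def)
qed

lemma is_even_cfrac_even_cfrac:
  assumes "0 \<le> x" "x < 1"
  shows "is_even_cfrac x (even_cfrac x)"
  unfolding even_cfrac_def by (rule theI') (rule ex1_even_cfrac[OF assms])

end

theory Submission
  imports Defs
begin

text \<open>
  A slope \<open>p / r\<close> in lowest terms with \<open>r s = p\<^sup>2 + 1\<close> is encoded by the symmetric matrix
  \<open>A = ((r, p), (p, s))\<close> of determinant one. If \<open>A\<close> and \<open>B\<close> encode neighbouring slopes \<open>\<alpha>\<close> and \<open>\<beta>\<close>,
  then \<open>\<alpha>.\<beta>\<close> is encoded by \<open>A K B\<close> with \<open>K = ((3, -1), (1, 0))\<close>, so that the matrices \<open>A K\<close> multiply.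
  A list \<open>as\<close> is a continued fraction of \<open>p / r\<close> as soon as \<open>A\<close> is the product \<open>M(as)\<close> of the matrices
  \<open>((a, 1), (1, 0))\<close>. On each of the intervals between \<open>0\<close>, \<open>1/2\<close> and \<open>1\<close> one conjugation takes the
  matrices \<open>A K\<close> of the two end points to \<open>M(1,1)\<close> and \<open>M(2,2)\<close>, in one order or the other. Hence the
  interior slopes give words in \<open>11\<close> and \<open>22\<close> with a fixed beginning and a fixed end, and undoing the
  conjugation changes only these ends: \<open>11 u 22\<close> becomes \<open>2 u 2\<close>, and \<open>22 u 11\<close> becomes \<open>11 u 11\<close>.
  The symmetry of \<open>A\<close> and the uniqueness of continued fractions give the palindrome.
\<close>

section \<open>Two by two integer matrices\<close>

datatype mat2 = Mat int int int int

instantiation mat2 :: monoid_mult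
begin

definition one_mat2 :: mat2 where
  "1 = Mat 1 0 0 1"

fun times_mat2 :: "mat2 \<Rightarrow> mat2 \<Rightarrow> mat2" where
  "Mat a b c d * Mat a' b' c' d' =
     Mat (a * a' + b * c') (a * b' + b * d') (c * a' + d * c') (c * b' + d * d')"

instance
proof
  show "A * B * C = A * (B * C)" for A B C :: mat2
    by (cases A; cases B; cases C) (simp add: algebra_simps)
  show "1 * A = A" "A * 1 = A" for A :: mat2
    by (cases A; simp add: one_mat2_def)+
qed

end

fun transpose2 :: "mat2 \<Rightarrow> mat2" where
  "transpose2 (Mat a b c d) = Mat a c b d"

lemma transpose2_mult: "transpose2 (A * B) = transpose2 B * transpose2 A"
  by (cases A; cases B) (simp add: algebra_simps)

section \<open>Continued fractions as matrix products\<close>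

definition cfrac_mat :: "nat list \<Rightarrow> mat2" where
  "cfrac_mat as = prod_list (map (\<lambda>a. Mat (int a) 1 1 0) as)"

lemma cfrac_mat_Nil: "cfrac_mat [] = 1"
  by (simp add: cfrac_mat_def)

lemma cfrac_mat_Cons: "cfrac_mat (a # as) = Mat (int a) 1 1 0 * cfrac_mat as"
  by (simp add: cfrac_mat_def)

lemma cfrac_mat_append: "cfrac_mat (as @ bs) = cfrac_mat as * cfrac_mat bs"
  by (simp add: cfrac_mat_def)

text \<open>Every factor is symmetric, so transposing the product reverses the list.\<close>

lemma cfrac_mat_rev: "cfrac_mat (rev as) = transpose2 (cfrac_mat as)"
proof (induction as)
  case Nil
  show ?case by (simp add: cfrac_mat_Nil one_mat2_def)
next
  case (Cons a as)
  have "cfrac_mat (rev (a # as)) = transpose2 (cfrac_mat as) * cfrac_mat [a]"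
    by (simp add: cfrac_mat_append Cons.IH)
  also have "\<dots> = transpose2 (cfrac_mat (a # as))"
    by (simp add: cfrac_mat_Cons cfrac_mat_Nil transpose2_mult)
  finally show ?case .
qed

text \<open>The first column holds denominator and numerator: the factor of a turns the column (x',
  z') into (a x' + z', x'). The signs are carried through the induction to keep denominators
  positive.\<close>

lemma cfrac_value_cfrac_mat:
  assumes "\<forall>a \<in> set as. a > 0" "cfrac_mat as = Mat x y z t"
  shows "x > 0 \<and> z \<ge> 0 \<and> cfrac_value as = of_int z / of_int x"
  using assms
proof (induction as arbitrary: x y z t)
  case Nil
  then show ?case by (simp add: cfrac_mat_Nil one_mat2_def)
next
  case (Cons a as)
  obtain x' y' z' t' where M: "cfrac_mat as = Mat x' y' z' t'" by (cases "cfrac_mat as")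
  have IH: "x' > 0" "z' \<ge> 0" "cfrac_value as = of_int z' / of_int x'"
    using Cons.IH[OF _ M] Cons.prems(1) by auto
  have xz: "x = int a * x' + z'" "z = x'"
    using Cons.prems(2) by (auto simp: cfrac_mat_Cons M)
  have "int a * x' > 0" using Cons.prems(1) IH(1) by simp
  then have "x > 0" using xz IH(2) by linarith
  moreover have "(of_int x :: rat) = of_int x' * (of_nat a + cfrac_value as)"
    using IH xz by (simp add: field_simps)
  ultimately show ?case using IH xz by simp
qed

lemma palindrome_iff_rev: "palindrome as \<longleftrightarrow> rev as = as"
proof -
  have "rev as = as \<longleftrightarrow> (\<forall>i < length as. as ! (length as - Suc i) = as ! i)"
    by (simp add: list_eq_iff_nth_eq rev_nth)
  then show ?thesis unfolding palindrome_def by (metis Suc_eq_plus1 diff_diff_left plus_1_eq_Suc)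
qed

section \<open>Matrices of slopes\<close>

definition encodes :: "mat2 \<Rightarrow> rat \<Rightarrow> bool" where
  "encodes A \<alpha> \<longleftrightarrow>
     (\<exists>r p s. A = Mat r p p s \<and> r > 0 \<and> r * s = p * p + 1 \<and> \<alpha> = of_int p / of_int r)"

lemma transpose2_encodes: "encodes A \<alpha> \<Longrightarrow> transpose2 A = A"
  by (auto simp: encodes_def)

lemma slope_rank_divide:
  assumes "r > 0" "r * s = p * p + 1"
  shows "slope_rank (of_int p / of_int r) = of_int r"
proof -
  have "coprime p r"
  proof (rule coprimeI)
    fix d assume "d dvd p" "d dvd r"
    then have "d dvd r * s - p * p" by simp
    then show "is_unit d" using assms(2) by simp
  qed
  then show ?thesis
    using assms(1) by (simp add: slope_rank_def Fract_of_int_quotient[symmetric]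
        quotient_of_Fract normalize_stable)
qed

text \<open>Chosen so that the upper left entry of \<open>A * K * B\<close> is r r' (3 + \<alpha> -
  \<beta>), which brings in the denominator of \<open>slope_dot\<close>. Its determinant is
  one.\<close>

definition K :: mat2 where
  "K = Mat 3 (- 1) 1 0"

text \<open>By symmetry the off-diagonal entry P has two expressions. Each, with one of the
  determinant conditions, gives the distance from P / R to one of the end points; comparing the two
  distances produces the discriminant term.\<close>

lemma encodes_slope_dot:
  assumes A: "encodes A \<alpha>" and B: "encodes B \<beta>"
    and sym: "transpose2 (A * K * B) = A * K * B" and less: "\<beta> < \<alpha> + 3"
  shows "encodes (A * K * B) (slope_dot \<alpha> \<beta>) \<and> \<alpha> < slope_dot \<alpha> \<beta> \<and> slope_dot \<alpha> \<beta> < \<beta>"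
proof -
  obtain r p s where a: "A = Mat r p p s" "r > 0" "r * s = p * p + 1" "\<alpha> = of_int p / of_int r"
    using A by (auto simp: encodes_def)
  obtain r' p' s' where b: "B = Mat r' p' p' s'" "r' > 0" "r' * s' = p' * p' + 1"
      "\<beta> = of_int p' / of_int r'"
    using B by (auto simp: encodes_def)
  define R P S where "R = (3 * r + p) * r' - r * p'" and "P = (3 * r + p) * p' - r * s'"
    and "S = (3 * p + s) * p' - p * s'"
  have M': "A * K * B = Mat R P ((3 * p + s) * r' - p * p') S"
    by (simp add: a(1) b(1) K_def P_def R_def S_def)
  \<comment> \<open>Only one entry is compared: injectivity would give the equation in both directions, a simp loop.\<close>
  have P': "P = (3 * p + s) * r' - p * p'"
    using arg_cong[OF sym, of "case_mat2 (\<lambda>a b c d. b)"]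
    by (simp only: M' transpose2.simps mat2.case)
  have M: "A * K * B = Mat R P P S"
    unfolding M' by (simp only: P'[symmetric])
  have gap: "3 + \<alpha> - \<beta> = of_int R / (of_int r * of_int r')"
    using a(2) b(2) unfolding a(4) b(4) by (simp add: R_def field_simps)
  have "of_int R / (of_int r * of_int r') > (0 :: rat)" using gap less by linarith
  then have "R > 0" using a(2) b(2) by (simp add: zero_less_divide_iff mult_less_0_iff)
  \<comment> \<open>This and \<open>above\<close> say that P / R exceeds \<alpha> by r' / (r R) and
    falls short of \<beta> by r / (r' R).\<close>
  have below: "r * P - p * R = r'"
  proof -
    have "r * P - p * R = r' * (r * s - p * p)" unfolding P' R_def by algebra
    then show ?thesis using a(3) by simp
  qed
  have above: "p' * R - r' * P = r"
  proof -
    have "p' * R - r' * P = r * (r' * s' - p' * p')" unfolding P_def R_def by algebra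
    then show ?thesis using b(3) by simp
  qed
  \<comment> \<open>Multiplicativity of the determinant, with det K = 1.\<close>
  have "R * S - P * P = (r * s - p * p) * (r' * s' - p' * p')"
  proof -
    have "R * S - P * ((3 * p + s) * r' - p * p') = (r * s - p * p) * (r' * s' - p' * p')"
      unfolding P_def R_def S_def by (simp add: algebra_simps)
    then show ?thesis by (simp only: P'[symmetric])
  qed
  then have det: "R * S = P * P + 1" using a(3) b(3) by simp
  have rank: "slope_rank \<alpha> = of_int r" "slope_rank \<beta> = of_int r'"
    unfolding a(4) b(4) by (rule slope_rank_divide[OF a(2,3)], rule slope_rank_divide[OF b(2,3)])
  \<comment> \<open>The difference of r' times \<open>below\<close> and r times
    \<open>above\<close>.\<close>
  have num: "2 * r * r' * P = (p * r' + r * p') * R + (r' * r' - r * r)"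
  proof -
    have "r' * r' = r' * (r * P - p * R)" "r * r = r * (p' * R - r' * P)"
      by (simp_all only: below above)
    then show ?thesis by (simp only:) (simp add: algebra_simps)
  qed
  define x x' y y' X Y :: rat where "x = of_int r" and "x' = of_int r'" and "y = of_int p"
    and "y' = of_int p'" and "X = of_int R" and "Y = of_int P"
  have pos: "x > 0" "x' > 0" "X > 0"
    using a(2) b(2) \<open>R > 0\<close> by (simp_all add: x_def x'_def X_def)
  have num': "2 * x * x' * Y = (y * x' + x * y') * X + (x' * x' - x * x)"
    using arg_cong[OF num, of "of_int :: int \<Rightarrow> rat"]
    by (simp only: of_int_mult of_int_add of_int_diff of_int_numeral x_def x'_def y_def y'_def X_def Y_def)
  have "slope_dot \<alpha> \<beta> = (y / x + y' / x') / 2 +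
      (1 / 2 * (1 - 1 / x'\<^sup>2) - 1 / 2 * (1 - 1 / x\<^sup>2)) / (X / (x * x'))"
    unfolding slope_dot_def slope_discriminant_def rank gap
    by (simp only: a(4) b(4) x_def x'_def y_def y'_def X_def)
  also have "\<dots> = ((y * x' + x * y') * X + (x' * x' - x * x)) / (2 * x * x' * X)"
    using pos by (simp add: divide_simps power2_eq_square) (simp add: algebra_simps)
  also have "\<dots> = Y / X" using pos unfolding num'[symmetric] by simp
  finally have dot: "slope_dot \<alpha> \<beta> = of_int P / of_int R" by (simp add: X_def Y_def)
  have "p * R < P * r" "P * r' < p' * R" using above below a(2) b(2) by (simp_all add: algebra_simps)
  then have "\<alpha> < of_int P / of_int R" "of_int P / of_int R < \<beta>"
    using a(2) b(2) \<open>R > 0\<close> unfolding a(4) b(4)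
    by (simp_all add: field_simps flip: of_int_mult)
  moreover have "encodes (A * K * B) (slope_dot \<alpha> \<beta>)"
    unfolding encodes_def using M \<open>R > 0\<close> det dot by blast
  ultimately show ?thesis by (simp only: dot simp_thms)
qed

text \<open>Passes the symmetry needed by \<open>encodes_slope_dot\<close> to both halves of a
  subdivided interval. The given symmetry reads \<open>B * transpose2 K * A = A * K * B\<close>, and
  this is substituted inside the longer transposed products.\<close>

lemma symmetric_mult_K:
  assumes "transpose2 A = A" "transpose2 B = B" and sym: "transpose2 (A * K * B) = A * K * B"
  shows "transpose2 (A * K * (A * K * B)) = A * K * (A * K * B)"
    and "transpose2 (A * K * B * K * B) = A * K * B * K * B"
proof -
  have flip: "B * transpose2 K * A = A * K * B"
    using assms by (simp add: transpose2_mult mult.assoc)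
  have "transpose2 (A * K * (A * K * B)) = A * K * B * transpose2 K * A"
    using assms by (simp add: transpose2_mult mult.assoc)
  also have "\<dots> = A * K * (B * transpose2 K * A)" by (simp add: mult.assoc)
  finally show "transpose2 (A * K * (A * K * B)) = A * K * (A * K * B)" by (simp only: flip)
  have "transpose2 (A * K * B * K * B) = B * transpose2 K * (A * K * B)"
    using assms by (metis transpose2_mult mult.assoc)
  also have "\<dots> = (B * transpose2 K * A) * K * B" by (simp add: mult.assoc)
  finally show "transpose2 (A * K * B * K * B) = A * K * B * K * B" by (simp only: flip)
qed

section \<open>Words of slopes\<close>

definition even_words :: "nat list set" where
  "even_words = {u. even (length u) \<and> set u \<subseteq> {1, 2}}"

text \<open>For invertible \<open>g\<close>, \<open>A * h = g * cfrac_mat v\<close> says that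
  \<open>A * K\<close> is conjugate by \<open>g\<close> to \<open>cfrac_mat v\<close>; this form
  avoids inverses. Induction over pairs of neighbours then concatenates their words.
  \<open>X\<close> and \<open>Y\<close> belong to the end points, and all words in between begin
  with \<open>X\<close> and end with \<open>Y\<close>. The bounds 0 and 1 ensure \<beta> < \<alpha>
  + 3.\<close>

lemma epsilon_level_words:
  fixes c :: int and X Y :: "nat list" and g h A\<^sub>0 B\<^sub>0 :: mat2 and \<alpha>\<^sub>0 \<beta>\<^sub>0 :: rat
  defines "I \<equiv> {X @ u @ Y | u. u \<in> even_words}"
  assumes words: "X \<in> even_words" "Y \<in> even_words"
    and base: "epsilon_level 1 c = \<alpha>\<^sub>0" "epsilon_level 1 (c + 1) = \<beta>\<^sub>0"
      "encodes A\<^sub>0 \<alpha>\<^sub>0" "encodes B\<^sub>0 \<beta>\<^sub>0"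
      "transpose2 (A\<^sub>0 * K * B\<^sub>0) = A\<^sub>0 * K * B\<^sub>0" "0 \<le> \<alpha>\<^sub>0" "\<beta>\<^sub>0 \<le> 1"
    and conj: "K * g = h" "A\<^sub>0 * h = g * cfrac_mat X" "B\<^sub>0 * h = g * cfrac_mat Y"
    and p: "c * 2 ^ q \<le> p" "p < (c + 1) * 2 ^ q"
  shows "\<exists>A B v w. encodes A (epsilon_level (Suc q) p) \<and> encodes B (epsilon_level (Suc q) (p + 1)) \<and>
    transpose2 (A * K * B) = A * K * B \<and>
    0 \<le> epsilon_level (Suc q) p \<and> epsilon_level (Suc q) (p + 1) \<le> 1 \<and>
    A * h = g * cfrac_mat v \<and> B * h = g * cfrac_mat w \<and>
    (epsilon_level (Suc q) p = \<alpha>\<^sub>0 \<and> v = X \<or> v \<in> I) \<and> (w = Y \<or> w \<in> I)"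
  using p
proof (induction q arbitrary: p)
  case 0
  then have "p = c" by simp
  then show ?case using base conj unfolding One_nat_def
    by (intro exI[of _ A\<^sub>0] exI[of _ B\<^sub>0] exI[of _ X] exI[of _ Y])
      (simp del: epsilon_level.simps)
next
  case (Suc q)
  define m where "m = p div 2"
  have "c * 2 ^ q \<le> m" "m < (c + 1) * 2 ^ q"
    using Suc.prems by (auto simp: m_def)
  then obtain A B v w where IH: "encodes A (epsilon_level (Suc q) m)"
      "encodes B (epsilon_level (Suc q) (m + 1))" "transpose2 (A * K * B) = A * K * B"
      "0 \<le> epsilon_level (Suc q) m" "epsilon_level (Suc q) (m + 1) \<le> 1"
      "A * h = g * cfrac_mat v" "B * h = g * cfrac_mat w"
      "epsilon_level (Suc q) m = \<alpha>\<^sub>0 \<and> v = X \<or> v \<in> I" "w = Y \<or> w \<in> I"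
    using Suc.IH by blast
  define \<alpha> \<beta> where "\<alpha> = epsilon_level (Suc q) m" and "\<beta> = epsilon_level (Suc q) (m + 1)"
  note IH = IH[folded \<alpha>_def \<beta>_def]
  have dot: "encodes (A * K * B) (slope_dot \<alpha> \<beta>)" "\<alpha> < slope_dot \<alpha> \<beta>" "slope_dot \<alpha> \<beta> < \<beta>"
    using encodes_slope_dot[OF IH(1,2,3)] IH(4,5) by auto
  note sym = symmetric_mult_K[OF IH(1,2)[THEN transpose2_encodes] IH(3)]
  have "A * K * B * h = A * (K * g) * cfrac_mat w" by (simp add: mult.assoc IH(7))
  also have "\<dots> = g * cfrac_mat (v @ w)" by (simp add: conj(1) IH(6) cfrac_mat_append mult.assoc)
  finally have vw: "A * K * B * h = g * cfrac_mat (v @ w)" .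
  have "v @ w \<in> I"
  proof -
    have v: "v = X \<or> (\<exists>u \<in> even_words. v = X @ u @ Y)"
      and w: "w = Y \<or> (\<exists>u \<in> even_words. w = X @ u @ Y)"
      using IH(8,9) by (auto simp: I_def)
    \<comment> \<open>Only the beginning of \<open>v\<close> and the end of \<open>w\<close> matter,
      so end points and interior slopes are treated alike.\<close>
    obtain u where "v = X @ u" "u \<in> even_words"
      using v words by (auto simp: even_words_def)
    moreover obtain u' where "w = u' @ Y" "u' \<in> even_words"
      using w words by (fastforce simp: even_words_def)
    ultimately have "v @ w = X @ (u @ u') @ Y" "u @ u' \<in> even_words"
      by (auto simp: even_words_def)
    then show ?thesis unfolding I_def by blast
  qed
  show ?case
  \<comment> \<open>The parity of \<open>p\<close> tells whether the new interval is the left or the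
    right half of the old one.\<close>
  proof (cases "even p")
    case True
    then have "(p + 1) div 2 = m" by (simp add: m_def)
    with True have "epsilon_level (Suc (Suc q)) p = \<alpha>"
      "epsilon_level (Suc (Suc q)) (p + 1) = slope_dot \<alpha> \<beta>"
      by (simp_all add: epsilon_level.simps(2)[of "Suc q"] \<alpha>_def \<beta>_def m_def del: epsilon_level.simps)
    then show ?thesis
      using IH dot vw sym(1) \<open>v @ w \<in> I\<close>
      by (intro exI[of _ A] exI[of _ "A * K * B"] exI[of _ v] exI[of _ "v @ w"])
        (auto simp del: epsilon_level.simps)
  next
    case False
    then have "(p + 1) div 2 = m + 1" by (simp add: m_def)
    with False have "epsilon_level (Suc (Suc q)) p = slope_dot \<alpha> \<beta>"
      "epsilon_level (Suc (Suc q)) (p + 1) = \<beta>"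
      by (simp_all add: epsilon_level.simps(2)[of "Suc q"] \<alpha>_def \<beta>_def m_def del: epsilon_level.simps)
    then show ?thesis
      using IH dot vw sym(2) \<open>v @ w \<in> I\<close>
      by (intro exI[of _ "A * K * B"] exI[of _ B] exI[of _ "v @ w"] exI[of _ w])
        (auto simp del: epsilon_level.simps)
  qed
qed

definition has_palindromic_word :: "rat \<Rightarrow> bool" where
  "has_palindromic_word \<alpha> \<longleftrightarrow> (\<exists>as \<in> even_words. is_even_cfrac \<alpha> as \<and> palindrome as)"

lemma has_palindromic_word_0: "has_palindromic_word 0"
  unfolding has_palindromic_word_def
  by (rule bexI[of _ "[]"]) (auto simp: even_words_def is_even_cfrac_def palindrome_def)

text \<open>The matrix is symmetric, so \<open>as\<close> and \<open>rev as\<close> have the same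
  matrix and the same value; their lengths agree, so uniqueness applies.\<close>

lemma has_palindromic_word_encodes:
  assumes "encodes (cfrac_mat as) \<alpha>" "as \<in> even_words"
  shows "has_palindromic_word \<alpha>"
proof -
  obtain r p s where M: "cfrac_mat as = Mat r p p s" "\<alpha> = of_int p / of_int r"
    using assms(1) by (auto simp: encodes_def)
  have pos: "\<forall>a \<in> set as. a > 0" and len: "even (length as)"
    using assms(2) by (auto simp: even_words_def)
  have "cfrac_mat (rev as) = Mat r p p s" by (simp add: cfrac_mat_rev M(1))
  then have "cfrac_value (rev as) = \<alpha>" "cfrac_value as = \<alpha>"
    using cfrac_value_cfrac_mat[of "rev as"] cfrac_value_cfrac_mat[of as] pos M by auto
  then have "rev as = as" "is_even_cfrac \<alpha> as"
    using cfrac_value_inject[of "rev as" as] pos len by (auto simp: is_even_cfrac_def)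
  then show ?thesis
    using assms(2) by (auto simp: has_palindromic_word_def palindrome_iff_rev)
qed

section \<open>The intervals [0, 1/2] and [1/2, 1]\<close>

lemma epsilon_level_1:
  "epsilon_level 1 0 = 0" "epsilon_level 1 1 = 1 / 2" "epsilon_level 1 2 = 1"
proof -
  have r: "slope_rank 0 = 1" "slope_rank 1 = 1" by (simp_all add: slope_rank_def)
  show "epsilon_level 1 0 = 0" "epsilon_level 1 1 = 1 / 2" "epsilon_level 1 2 = 1"
    by (simp_all add: slope_dot_def slope_discriminant_def r)
qed

lemma encodes_base:
  "encodes 1 0" "encodes (Mat 2 1 1 1) (1 / 2)" "encodes (Mat 1 1 1 2) 1"
  by (auto simp: encodes_def one_mat2_def)

lemma has_palindromic_word_lower:
  assumes "0 \<le> p" "p < 2 ^ q"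
  shows "has_palindromic_word (epsilon_level (Suc q) p)"
proof -
  let ?\<alpha> = "epsilon_level (Suc q) p"
  \<comment> \<open>Here \<open>b\<close> is both \<open>K * g\<close> and the matrix of the
    one-letter word 2.\<close>
  define g b where "g = Mat 1 0 1 (- 1)" and "b = Mat 2 1 1 0"
  have sym: "transpose2 (1 * K * Mat 2 1 1 1) = 1 * K * Mat 2 1 1 1" by (simp add: K_def one_mat2_def)
  have conj: "K * g = b" "1 * b = g * cfrac_mat [1, 1]" "Mat 2 1 1 1 * b = g * cfrac_mat [2, 2]"
    by (simp_all add: K_def g_def b_def one_mat2_def cfrac_mat_Cons cfrac_mat_Nil)
  have words: "[1, 1] \<in> even_words" "[2, 2] \<in> even_words" by (simp_all add: even_words_def)
  have level: "epsilon_level 1 (0 + 1) = 1 / 2" unfolding add_0 by (rule epsilon_level_1)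
  have range: "0 * 2 ^ q \<le> p" "p < (0 + 1) * 2 ^ q" using assms by simp_all
  obtain A v where A: "encodes A ?\<alpha>" "A * b = g * cfrac_mat v"
    and v: "?\<alpha> = 0 \<or> (\<exists>u \<in> even_words. v = [1, 1] @ u @ [2, 2])"
    using epsilon_level_words[OF words epsilon_level_1(1) level encodes_base(1,2) sym _ _ conj range]
    by fastforce
  \<comment> \<open>The word 11 of the end point 0 lacks the final 22 that is cancelled below; the
    expansion of 0 is empty.\<close>
  show ?thesis
  proof (cases "?\<alpha> = 0")
    case True
    then show ?thesis by (simp add: has_palindromic_word_0)
  next
    case False
    then obtain u where u: "u \<in> even_words" "v = [1, 1] @ u @ [2, 2]" using v by auto
    have ga: "g * cfrac_mat [1, 1] = b"
      by (simp add: g_def b_def cfrac_mat_Cons cfrac_mat_Nil one_mat2_def)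
    have bb: "cfrac_mat [2, 2] = b * b" "cfrac_mat [2] = b"
      by (simp_all add: b_def cfrac_mat_Cons cfrac_mat_Nil one_mat2_def)
    have binv: "b * Mat 0 1 1 (- 2) = 1" by (simp add: b_def one_mat2_def)
    have "A * b = (g * cfrac_mat [1, 1]) * cfrac_mat u * (b * b)"
      unfolding A(2) u(2) cfrac_mat_append bb by (simp add: mult.assoc)
    also have "\<dots> = cfrac_mat ([2] @ u @ [2]) * b"
      unfolding cfrac_mat_append bb ga by (simp add: mult.assoc)
    finally have "A * b * Mat 0 1 1 (- 2) = cfrac_mat ([2] @ u @ [2]) * b * Mat 0 1 1 (- 2)"
      by simp
    then have "A = cfrac_mat ([2] @ u @ [2])" by (simp only: mult.assoc binv mult_1_right)
    then show ?thesis
      using A(1) u(1) by (intro has_palindromic_word_encodes[of "[2] @ u @ [2]"]) (auto simp: even_words_def)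
  qed
qed

lemma has_palindromic_word_upper:
  assumes "2 ^ q \<le> p" "p < 2 * 2 ^ q"
  shows "has_palindromic_word (epsilon_level (Suc q) p)"
proof -
  let ?\<alpha> = "epsilon_level (Suc q) p"
  \<comment> \<open>The inverse of \<open>K\<close>, so that \<open>h\<close> is the
    identity.\<close>
  define g where "g = Mat 0 1 (- 1) 3"
  have sym: "transpose2 (Mat 2 1 1 1 * K * Mat 1 1 1 2) = Mat 2 1 1 1 * K * Mat 1 1 1 2"
    by (simp add: K_def)
  have conj: "K * g = 1" "Mat 2 1 1 1 * 1 = g * cfrac_mat [2, 2]"
    "Mat 1 1 1 2 * 1 = g * cfrac_mat [1, 1]"
    by (simp_all add: K_def g_def one_mat2_def cfrac_mat_Cons cfrac_mat_Nil)
  have words: "[2, 2] \<in> even_words" "[1, 1] \<in> even_words" by (simp_all add: even_words_def)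
  have level: "epsilon_level 1 (1 + 1) = 1" unfolding one_add_one by (rule epsilon_level_1)
  have range: "1 * 2 ^ q \<le> p" "p < (1 + 1) * 2 ^ q" using assms by simp_all
  obtain A v where A: "encodes A ?\<alpha>" "A * 1 = g * cfrac_mat v"
    and v: "v = [2, 2] \<or> (\<exists>u \<in> even_words. v = [2, 2] @ u @ [1, 1])"
    using epsilon_level_words[OF words epsilon_level_1(2) level encodes_base(2,3) sym _ _ conj range]
    by fastforce
  note A = A(1) A(2)[unfolded mult_1_right]
  have gb: "g * cfrac_mat [2, 2] = cfrac_mat [1, 1]"
    by (simp add: g_def cfrac_mat_Cons cfrac_mat_Nil one_mat2_def)
  obtain as where "A = cfrac_mat as" "as \<in> even_words"
  proof (cases "v = [2, 2]")
    case True
    then show ?thesis using A(2) gb by (intro that[of "[1, 1]"]) (auto simp: even_words_def)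
  next
    case False
    then obtain u where u: "u \<in> even_words" "v = [2, 2] @ u @ [1, 1]" using v by auto
    have "A = (g * cfrac_mat [2, 2]) * cfrac_mat u * cfrac_mat [1, 1]"
      unfolding A(2) u(2) cfrac_mat_append by (simp add: mult.assoc)
    then have "A = cfrac_mat ([1, 1] @ u @ [1, 1])"
      unfolding gb cfrac_mat_append by (simp add: mult.assoc)
    then show ?thesis using u(1) by (intro that[of "[1, 1] @ u @ [1, 1]"]) (auto simp: even_words_def)
  qed
  then show ?thesis using A(1) has_palindromic_word_encodes by blast
qed

lemma has_palindromic_word_epsilon_level:
  assumes "0 \<le> p" "p < 2 ^ q"
  shows "has_palindromic_word (epsilon_level q p)"
proof (cases q)
  case 0
  then have "p = 0" using assms by simp
  then show ?thesis using 0 by (simp add: has_palindromic_word_0)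
next
  case (Suc n)
  then show ?thesis
    using assms has_palindromic_word_lower[of p n] has_palindromic_word_upper[of n p]
    by (cases "p < 2 ^ n") auto
qed

section \<open>Translation by integers\<close>

lemma slope_rank_add_of_int: "slope_rank (\<alpha> + of_int k) = slope_rank \<alpha>"
proof -
  obtain p r where pr: "quotient_of \<alpha> = (p, r)" by force
  have \<alpha>: "\<alpha> = of_int p / of_int r" and r: "r > 0" and "coprime p r"
    using pr quotient_of_div quotient_of_denom_pos quotient_of_coprime by blast+
  have "\<alpha> + of_int k = Fract (p + k * r) r"
    using \<alpha> r by (simp add: Fract_of_int_quotient field_simps)
  moreover have "coprime (p + k * r) r"
    using \<open>coprime p r\<close> by (metis add.commute coprime_commute gcd_add_mult coprime_iff_gcd_eq_1)
  ultimately show ?thesis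
    using pr r by (simp add: slope_rank_def quotient_of_Fract normalize_stable)
qed

lemma slope_dot_add_of_int: "slope_dot (\<alpha> + of_int k) (\<beta> + of_int k) = slope_dot \<alpha> \<beta> + of_int k"
proof -
  have "3 + (\<alpha> + of_int k) - (\<beta> + of_int k) = 3 + \<alpha> - \<beta>"
    "(\<alpha> + of_int k + (\<beta> + of_int k)) / 2 = (\<alpha> + \<beta>) / 2 + of_int k"
    by (simp_all add: field_simps)
  then show ?thesis
    by (simp only: slope_dot_def slope_discriminant_def slope_rank_add_of_int ac_simps)
qed

lemma epsilon_level_add: "epsilon_level q (p + k * 2 ^ q) = epsilon_level q p + of_int k"
proof (induction q arbitrary: p)
  case (Suc q)
  have div: "(p + k * 2 ^ Suc q) div 2 = p div 2 + k * 2 ^ q"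
    by simp
  have shift: "p div 2 + k * 2 ^ q + 1 = (p div 2 + 1) + k * 2 ^ q" by simp
  have "even (p + k * 2 ^ Suc q) \<longleftrightarrow> even p" by simp
  then show ?case
    by (simp only: epsilon_level.simps div shift Suc.IH slope_dot_add_of_int split: if_split) simp
qed simp

theorem theorem1p2:
  fixes \<alpha> :: rat
  assumes "\<alpha> \<in> exceptional_slopes"
  shows "set (even_cfrac (frac \<alpha>)) \<subseteq> {1, 2} \<and> palindrome (even_cfrac (frac \<alpha>))"
proof -
  obtain p q where "\<alpha> = epsilon_level q p"
    using assms by (auto simp: exceptional_slopes_def dyadics_def epsilon_dyadic)
  define \<beta> where "\<beta> = epsilon_level q (p mod 2 ^ q)"
  have "\<alpha> = \<beta> + of_int (p div 2 ^ q)"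
    unfolding \<open>\<alpha> = _\<close> \<beta>_def epsilon_level_add[symmetric] mod_div_mult_eq ..
  obtain as where as: "as \<in> even_words" "is_even_cfrac \<beta> as" "palindrome as"
    using has_palindromic_word_epsilon_level[of "p mod 2 ^ q" q]
    by (auto simp: has_palindromic_word_def \<beta>_def)
  \<comment> \<open>The even length of \<open>as\<close> alone places its value in [0, 1);
    monotonicity of \<open>epsilon\<close> does not enter.\<close>
  have bounds: "0 \<le> \<beta>" "\<beta> < 1"
    using as(2) cfrac_value_bounds[of as] by (auto simp: is_even_cfrac_def)
  then have "frac \<alpha> = \<beta>" by (simp add: frac_unique_iff \<open>\<alpha> = \<beta> + _\<close>)
  moreover have "even_cfrac \<beta> = as"
    using ex1_even_cfrac[OF bounds] is_even_cfrac_even_cfrac[OF bounds] as(2) by blast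
  ultimately show ?thesis using as by (simp add: even_words_def)
qed

end
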